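(* Let $c,k$ be fixed positive integers with $c\le k$, and let $s=s(n)$ be an integer-valued function with $s(n)\ge c$ for all $n$. If $s(n)=o(n^{1/c^2})$ as $n\to\infty$, then $p(n,c,k,s(n))=o(1)$, i.e. $\lim_{n\to\infty}p(n,c,k,s(n))=0$.
   Context: $C_n^k$ denotes the $k$-th power of the cycle on $n$ vertices: its vertex set is $\{0,\ldots,n-1\}$, and distinct vertices $i,j$ are adjacent iff $(i-j) \bmod n\in\{-k,\ldots,-1,1,\ldots,k\}$ (residues modulo $n$), i.e. iff their distance along the cycle is at most $k$. Given a set $L(x)$ of colours for each vertex $x$ of a graph $G$, an $L$-colouring of $G$ is a map $f$ from $V(G)$ to the colours with $f(x)\in L(x)$ for all $x\in V(G)$ and $f(x)\ne f(y)$ for every edge $(x,y)\in E(G)$; $G$ is $L$-colourable if it has an $L$-colouring. Let $\mathcal{S}$ be a set of colours of size $s(n)$. For each vertex of $C_n^k$, independently, draw a subset of $\mathcal{S}$ of size $c$ uniformly at random among all $c$-element subsets of $\mathcal{S}$; this gives a random list assignment $L$. Then $p(n,c,k,s(n))$ is the probability that $C_n^k$ is $L$-colourable. The parameters $c,k$ are fixed and all asymptotics are as $n\to\infty$; $f=o(g)$ means $\lim_{n\to\infty} f/g=0$. *)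

theory Defs
  imports "HOL-Probability.Probability" "HOL-Library.Landau_Symbols" "HOL-Number_Theory.Cong"
begin

text \<open>A finite simple graph is given by its vertex set and a symmetric, irreflexive edge relation.\<close>

definition cycle_power_verts :: "nat \<Rightarrow> nat set" where
  "cycle_power_verts n = {..<n}"

definition cycle_power_edges :: "nat \<Rightarrow> nat \<Rightarrow> (nat \<times> nat) set" where
  "cycle_power_edges n k =
     {(i, j). i \<in> cycle_power_verts n \<and> j \<in> cycle_power_verts n \<and> i \<noteq> j \<and>
        (\<exists>d \<in> {- int k..-1} \<union> {1..int k}. [int i - int j = d] (mod int n))}"

lemma cycle_power_edges_irrefl: "irrefl (cycle_power_edges n k)"
  by (auto simp: irrefl_def cycle_power_edges_def)

lemma cycle_power_edges_sym: "sym (cycle_power_edges n k)"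
proof (rule symI)
  fix i j assume "(i, j) \<in> cycle_power_edges n k"
  then obtain d where ij: "i \<in> cycle_power_verts n" "j \<in> cycle_power_verts n" "i \<noteq> j"
    and d: "d \<in> {- int k..-1} \<union> {1..int k}" "[int i - int j = d] (mod int n)"
    unfolding cycle_power_edges_def by blast
  have "[int j - int i = - d] (mod int n)"
    using d(2) cong_minus_minus_iff[of "int i - int j" d "int n"] by simp
  moreover have "- d \<in> {- int k..-1} \<union> {1..int k}" using d(1) by auto
  ultimately show "(j, i) \<in> cycle_power_edges n k"
    using ij unfolding cycle_power_edges_def by blast
qed

definition list_colouring ::
  "'v set \<Rightarrow> ('v \<times> 'v) set \<Rightarrow> ('v \<Rightarrow> 'a set) \<Rightarrow> ('v \<Rightarrow> 'a) \<Rightarrow> bool" where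
  "list_colouring V E L f \<longleftrightarrow> (\<forall>x\<in>V. f x \<in> L x) \<and> (\<forall>(x, y)\<in>E. f x \<noteq> f y)"

definition list_colourable :: "'v set \<Rightarrow> ('v \<times> 'v) set \<Rightarrow> ('v \<Rightarrow> 'a set) \<Rightarrow> bool" where
  "list_colourable V E L \<longleftrightarrow> (\<exists>f. list_colouring V E L f)"

text \<open>The lists of distinct vertices are independent; \<open>{}\<close> is the dummy value that
  \<^const>\<open>Pi_pmf\<close> assigns outside the vertex set. Meaningful when \<open>S\<close> is finite with at least
  \<open>c\<close> elements, so that \<^const>\<open>pmf_of_set\<close> is applied to a finite nonempty set.\<close>

definition random_lists :: "'v set \<Rightarrow> nat \<Rightarrow> 'a set \<Rightarrow> ('v \<Rightarrow> 'a set) pmf" where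
  "random_lists V c S = Pi_pmf V {} (\<lambda>_. pmf_of_set {A. A \<subseteq> S \<and> card A = c})"

text \<open>This is $p(n,c,k,s)$ for a colour set \<open>S\<close> of size $s$; its value depends on \<open>S\<close>
  only through its cardinality.\<close>

definition colourable_prob :: "nat \<Rightarrow> nat \<Rightarrow> nat \<Rightarrow> 'a set \<Rightarrow> real" where
  "colourable_prob n c k S =
     measure_pmf.prob (random_lists (cycle_power_verts n) c S)
       {L. list_colourable (cycle_power_verts n) (cycle_power_edges n k) L}"

end

theory Submission
  imports Defs
begin

text \<open>The vertices split into \<open>n div (c + 1)\<close> disjoint runs of \<open>c + 1\<close> consecutive vertices, each a
  clique since \<open>c \<le> k\<close>. A run whose vertices all receive the same \<open>c\<close> colours cannot be coloured,
  and this happens with probability \<open>1 / (s choose c) ^ c \<ge> 1 / s ^ (c\<^sup>2)\<close>, independently for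
  distinct runs. Hence \<open>p \<le> exp (- (n div (c + 1)) / s ^ (c\<^sup>2))\<close>, and the exponent tends
  to \<open>- \<infinity>\<close> because \<open>s ^ (c\<^sup>2) = o(n)\<close>.\<close>

text \<open>Independence of two disjoint coordinate blocks. A product over
  \<open>A \<union> B\<close> is the image of a pair of independent products under gluing. The
  assumptions on \<open>P\<close> and \<open>Q\<close> say that each event looks only at its own
  block, so the preimage of the conjunction is a rectangle.\<close>

lemma prob_Pi_pmf_union_conj:
  assumes "finite A" "finite B" "A \<inter> B = {}"
    and P: "\<And>f g. (\<And>x. x \<in> A \<Longrightarrow> f x = g x) \<Longrightarrow> P f = P g"
    and Q: "\<And>f g. (\<And>x. x \<in> B \<Longrightarrow> f x = g x) \<Longrightarrow> Q f = Q g"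
  shows "measure_pmf.prob (Pi_pmf (A \<union> B) d p) {f. P f \<and> Q f} =
    measure_pmf.prob (Pi_pmf A d p) {f. P f} * measure_pmf.prob (Pi_pmf B d p) {f. Q f}"
proof -
  let ?h = "\<lambda>(f, g) x. if x \<in> A then f x else g x"
  let ?p = "pair_pmf (Pi_pmf A d p) (Pi_pmf B d p)"
  have "P (?h (f, g)) = P f" "Q (?h (f, g)) = Q g" for f g
    using assms(3) by (auto intro!: P Q)
  then have "?h -` {f. P f \<and> Q f} = {f. P f} \<times> {f. Q f}"
    by auto
  then have "measure_pmf.prob (Pi_pmf (A \<union> B) d p) {f. P f \<and> Q f} =
      measure_pmf.prob ?p ({f. P f} \<times> {f. Q f})"
    using assms(1-3) by (simp add: Pi_pmf_union)
  \<comment> \<open>Both sides of the rectangle are cut down to the supports, which are countable as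
    \<open>measure_pmf_prob_product\<close> requires; this does not change the probability.\<close>
  also have "\<dots> = measure_pmf.prob ?p (({f. P f} \<inter> set_pmf (Pi_pmf A d p)) \<times>
      ({f. Q f} \<inter> set_pmf (Pi_pmf B d p)))"
    by (subst measure_Int_set_pmf [symmetric]) (simp add: Times_Int_Times)
  also have "\<dots> = measure_pmf.prob (Pi_pmf A d p) {f. P f} * measure_pmf.prob (Pi_pmf B d p) {f. Q f}"
    by (subst measure_pmf_prob_product) (auto simp: measure_Int_set_pmf)
  finally show ?thesis .
qed

text \<open>Induction on the index set, splitting off one block \<open>B i\<close> at a time. The
  remaining events live on \<open>A - B i\<close>, which is why \<open>A\<close> varies in the
  induction. The blocks may leave part of \<open>A\<close> uncovered.\<close>

lemma prob_Pi_pmf_Ball_blocks: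
  assumes "finite J" "finite A" "\<And>j. j \<in> J \<Longrightarrow> B j \<subseteq> A" "disjoint_family_on B J"
    and P: "\<And>j f g. j \<in> J \<Longrightarrow> (\<And>x. x \<in> B j \<Longrightarrow> f x = g x) \<Longrightarrow> P j f = P j g"
  shows "measure_pmf.prob (Pi_pmf A d p) {f. \<forall>j\<in>J. P j f} =
    (\<Prod>j\<in>J. measure_pmf.prob (Pi_pmf (B j) d p) {f. P j f})"
  using assms
proof (induction J arbitrary: A rule: finite_induct)
  case empty
  then show ?case by simp
next
  case (insert i J)
  have sub: "B j \<subseteq> A - B i" if "j \<in> J" for j
    using insert.prems(2) [of j] insert.prems(3) insert.hyps(2) that
    unfolding disjoint_family_on_def by fastforce
  have dep: "(\<forall>j\<in>J. P j f) = (\<forall>j\<in>J. P j g)" if "\<And>x. x \<in> A - B i \<Longrightarrow> f x = g x" for f g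
    using sub that insert.prems(4) by (meson insertCI subsetD)
  have "measure_pmf.prob (Pi_pmf (B i \<union> (A - B i)) d p) {f. P i f \<and> (\<forall>j\<in>J. P j f)} =
      measure_pmf.prob (Pi_pmf (B i) d p) {f. P i f} *
      measure_pmf.prob (Pi_pmf (A - B i) d p) {f. \<forall>j\<in>J. P j f}"
  proof (rule prob_Pi_pmf_union_conj)
    show "finite (B i)" "finite (A - B i)"
      using insert.prems(1,2) by (auto intro: finite_subset)
    show "P i f = P i g" if "\<And>x. x \<in> B i \<Longrightarrow> f x = g x" for f g
      using insert.prems(4) [of i f g] that by simp
  qed (auto intro!: dep)
  moreover have "B i \<union> (A - B i) = A"
    using insert.prems(2) by auto
  moreover have "measure_pmf.prob (Pi_pmf (A - B i) d p) {f. \<forall>j\<in>J. P j f} =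
      (\<Prod>j\<in>J. measure_pmf.prob (Pi_pmf (B j) d p) {f. P j f})"
  proof (rule insert.IH)
    show "disjoint_family_on B J"
      using insert.prems(3) by (rule disjoint_family_on_mono [rotated]) auto
    show "P j f = P j g" if "j \<in> J" "\<And>x. x \<in> B j \<Longrightarrow> f x = g x" for j f g
      using insert.prems(4) [of j f g] that by simp
  qed (use insert.prems(1) sub in simp_all)
  ultimately show ?case
    using insert.hyps by simp
qed

text \<open>Counting: of the \<open>card T ^ card B\<close> equally likely functions exactly
  \<open>card T\<close> are constant on \<open>B\<close>, one for each value in
  \<open>T\<close>.\<close>

lemma prob_Pi_pmf_of_set_constant:
  assumes "finite B" "B \<noteq> {}" "finite T" "T \<noteq> {}"
  shows "measure_pmf.prob (Pi_pmf B d (\<lambda>_. pmf_of_set T)) {f. \<exists>t\<in>T. \<forall>x\<in>B. f x = t} =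
    1 / real (card T) ^ (card B - 1)"
proof -
  let ?D = "PiE_dflt B d (\<lambda>_. T)" and ?C = "{f. \<exists>t\<in>T. \<forall>x\<in>B. f x = t}"
  \<comment> \<open>Members of \<open>?D\<close> equal \<open>d\<close> off \<open>B\<close>, so a
    function in the intersection is determined by its constant value. Since \<open>B\<close> is
    nonempty, different values give different functions.\<close>
  have "?D \<inter> ?C = (\<lambda>t x. if x \<in> B then t else d) ` T"
    by (auto simp: PiE_dflt_def image_def fun_eq_iff; metis)
  moreover have "inj_on (\<lambda>t x. if x \<in> B then t else d) T"
    using assms(2) by (auto simp: inj_on_def fun_eq_iff)
  ultimately have "card (?D \<inter> ?C) = card T"
    by (simp add: card_image)
  moreover have "card ?D = card T ^ card B"
    using assms by (simp add: card_PiE_dflt)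
  moreover have "Pi_pmf B d (\<lambda>_. pmf_of_set T) = pmf_of_set ?D"
    using assms by (intro Pi_pmf_of_set) auto
  moreover have "finite ?D" "?D \<noteq> {}"
    using assms by auto
  moreover have "card B = Suc (card B - 1)" "card T > 0"
    using assms by (simp_all add: card_gt_0_iff)
  moreover have "real (card T) ^ card B = real (card T) * real (card T) ^ (card B - 1)"
    using \<open>card B = Suc (card B - 1)\<close> by (metis power_Suc)
  ultimately show ?thesis
    by (simp add: measure_pmf_of_set)
qed

text \<open>Pigeonhole: a colouring would inject the clique into the common list, which is too
  small.\<close>

lemma not_list_colourable_clique:
  assumes "K \<subseteq> V" "finite A" "card A < card K"
    and "\<And>x y. x \<in> K \<Longrightarrow> y \<in> K \<Longrightarrow> x \<noteq> y \<Longrightarrow> (x, y) \<in> E"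
    and "\<And>x. x \<in> K \<Longrightarrow> L x = A"
  shows "\<not> list_colourable V E L"
proof
  assume "list_colourable V E L"
  then obtain f where f: "\<And>x. x \<in> V \<Longrightarrow> f x \<in> L x" "\<And>x y. (x, y) \<in> E \<Longrightarrow> f x \<noteq> f y"
    unfolding list_colourable_def list_colouring_def by blast
  have "inj_on f K"
    using f(2) assms(4) by (meson inj_onI)
  moreover have "f ` K \<subseteq> A"
    using f(1) assms(1,5) by blast
  ultimately show False
    using card_inj_on_le [of f K A] assms(2,3) by simp
qed

text \<open>The interval does not wrap around the cycle, so the integer difference itself is a valid
  residue \<open>d\<close>.\<close>

lemma cycle_power_edges_interval:
  assumes "x \<in> {a..a + k}" "y \<in> {a..a + k}" "x \<noteq> y" "a + k < n"
  shows "(x, y) \<in> cycle_power_edges n k"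
proof -
  have "int x - int y \<in> {- int k..-1} \<union> {1..int k}"
    using assms by auto
  moreover have "x < n" "y < n"
    using assms by auto
  ultimately show ?thesis
    using assms(3) unfolding cycle_power_edges_def cycle_power_verts_def
    by (auto intro!: bexI [of _ "int x - int y"])
qed

lemma cycle_power_edges_mono: "k \<le> l \<Longrightarrow> cycle_power_edges n k \<subseteq> cycle_power_edges n l"
  unfolding cycle_power_edges_def by fastforce

lemma colourable_prob_le:
  fixes S :: "'a set"
  assumes "c \<le> k" "finite S" "c \<le> card S"
  shows "colourable_prob n c k S \<le> (1 - 1 / real (card S choose c) ^ c) ^ (n div (c + 1))"
proof -
  define T where "T = {A. A \<subseteq> S \<and> card A = c}"
  \<comment> \<open>The length \<open>c + 1\<close> is the least that defeats \<open>c\<close>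
    common colours, and \<open>c \<le> k\<close> still makes such a run a clique.\<close>
  define B where "B j = {j * (c + 1)..j * (c + 1) + c}" for j :: nat
  define P where "P j L \<longleftrightarrow> (\<exists>A\<in>T. \<forall>x\<in>B j. L x = A)" for j and L :: "nat \<Rightarrow> 'a set"
  let ?J = "{..<n div (c + 1)}"
  have T: "finite T" "card T = card S choose c"
    using assms(2) by (simp_all add: T_def n_subsets)
  then have "card T > 0"
    using assms(3) by simp
  then have "T \<noteq> {}"
    by auto
  have B: "finite (B j)" "B j \<noteq> {}" "card (B j) = Suc c" for j
    by (simp_all add: B_def)
  \<comment> \<open>All chosen runs end before \<open>n\<close>, so none wraps around; the last
    \<open>n mod (c + 1)\<close> vertices belong to no run.\<close>
  have Bn: "j * (c + 1) + c < n" if "j \<in> ?J" for j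
  proof -
    have "Suc j * (c + 1) \<le> n div (c + 1) * (c + 1)"
      using that by (intro mult_right_mono) auto
    also have "\<dots> \<le> n"
      by (rule div_times_less_eq_dividend)
    finally show ?thesis
      by simp
  qed
  \<comment> \<open>The run index can be recovered from any of its vertices, which gives
    disjointness.\<close>
  have div: "x div (c + 1) = j" if "x \<in> B j" for x j
    using that by (intro div_nat_eqI) (auto simp: B_def algebra_simps)
  have disj: "disjoint_family_on B ?J"
    using div unfolding disjoint_family_on_def by (metis disjoint_iff)
  have "{L. list_colourable (cycle_power_verts n) (cycle_power_edges n k) L} \<subseteq>
      {L. \<forall>j\<in>?J. \<not> P j L}"
  proof (intro subsetI CollectI ballI notI)
    fix L j
    assume L: "L \<in> {L. list_colourable (cycle_power_verts n) (cycle_power_edges n k) L}"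
      and j: "j \<in> ?J" and "P j L"
    then obtain A where A: "A \<in> T" "\<And>x. x \<in> B j \<Longrightarrow> L x = A"
      unfolding P_def by blast
    have "\<not> list_colourable (cycle_power_verts n) (cycle_power_edges n k) L"
    proof (rule not_list_colourable_clique [where K = "B j" and A = A])
      show "B j \<subseteq> cycle_power_verts n"
        using Bn [OF j] by (auto simp: B_def cycle_power_verts_def)
      show "finite A" "card A < card (B j)"
        using A(1) assms(2) B(3) by (auto simp: T_def intro: finite_subset)
      \<comment> \<open>The run is a clique already in the \<open>c\<close>-th power of the cycle,
        whose edges are among those of the \<open>k\<close>-th.\<close>
      show "(x, y) \<in> cycle_power_edges n k" if "x \<in> B j" "y \<in> B j" "x \<noteq> y" for x y
        using that Bn [OF j] cycle_power_edges_interval cycle_power_edges_mono [OF assms(1)]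
        unfolding B_def by blast
    qed (fact A(2))
    with L show False
      by simp
  qed
  then have "colourable_prob n c k S \<le>
      measure_pmf.prob (random_lists (cycle_power_verts n) c S) {L. \<forall>j\<in>?J. \<not> P j L}"
    unfolding colourable_prob_def by (intro measure_pmf.finite_measure_mono) auto
  also have "\<dots> = (\<Prod>j\<in>?J. measure_pmf.prob (Pi_pmf (B j) {} (\<lambda>_. pmf_of_set T)) {L. \<not> P j L})"
    unfolding random_lists_def T_def [symmetric]
  proof (rule prob_Pi_pmf_Ball_blocks [OF _ _ _ disj])
    show "B j \<subseteq> cycle_power_verts n" if "j \<in> ?J" for j
      using Bn [OF that] by (auto simp: B_def cycle_power_verts_def)
    show "(\<not> P j f) = (\<not> P j g)" if "\<And>x. x \<in> B j \<Longrightarrow> f x = g x" for j f g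
      using that by (simp add: P_def)
  qed (simp_all add: cycle_power_verts_def)
  also have "\<dots> = (\<Prod>j\<in>?J. 1 - 1 / real (card S choose c) ^ c)"
  proof (intro prod.cong refl)
    fix j
    have "measure_pmf.prob (Pi_pmf (B j) {} (\<lambda>_. pmf_of_set T)) {L. \<not> P j L} =
        1 - measure_pmf.prob (Pi_pmf (B j) {} (\<lambda>_. pmf_of_set T)) {L. P j L}"
      by (subst measure_pmf.prob_compl [symmetric]) (auto intro: arg_cong2 [where f = measure])
    \<comment> \<open>The exponent is \<open>card (B j) - 1 = c\<close>: the first list of the run
      is free, the other \<open>c\<close> must agree with it.\<close>
    also have "\<dots> = 1 - 1 / real (card S choose c) ^ c"
      unfolding P_def using B T \<open>T \<noteq> {}\<close> by (simp add: prob_Pi_pmf_of_set_constant)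
    finally show "measure_pmf.prob (Pi_pmf (B j) {} (\<lambda>_. pmf_of_set T)) {L. \<not> P j L} =
        1 - 1 / real (card S choose c) ^ c" .
  qed
  finally show ?thesis
    by simp
qed

text \<open>Combines \<open>1 - x \<le> exp (- x)\<close> with the crude bound of the binomial
  coefficient by \<open>card S ^ c\<close>, whose \<open>c\<close>-th power produces the exponent
  \<open>c * c\<close>.\<close>

lemma colourable_prob_le_exp:
  assumes "c \<le> k" "finite S" "c \<le> card S" "c \<ge> 1"
  shows "colourable_prob n c k S \<le> exp (- (real (n div (c + 1)) / real (card S) ^ c\<^sup>2))"
proof -
  define N where "N = card S choose c"
  have N: "N \<ge> 1"
    using assms(3) unfolding N_def by (simp add: Suc_le_eq)
  have "real N ^ c \<le> (real (card S) ^ c) ^ c"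
    using binomial_le_pow [OF assms(3)] by (intro power_mono) (auto simp: N_def simp flip: of_nat_power)
  then have le: "1 / real (card S) ^ c\<^sup>2 \<le> 1 / real N ^ c"
    using N by (intro divide_left_mono) (use assms(3,4) in \<open>auto simp: power_mult power2_eq_square\<close>)
  have "colourable_prob n c k S \<le> (1 - 1 / real N ^ c) ^ (n div (c + 1))"
    unfolding N_def using assms by (intro colourable_prob_le)
  also have "\<dots> \<le> exp (- (1 / real (card S) ^ c\<^sup>2)) ^ (n div (c + 1))"
  proof (rule power_mono)
    show "1 - 1 / real N ^ c \<le> exp (- (1 / real (card S) ^ c\<^sup>2))"
      using le exp_ge_add_one_self [of "- (1 / real (card S) ^ c\<^sup>2)"] by linarith
    show "0 \<le> 1 - 1 / real N ^ c"
      using N by simp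
  qed
  also have "\<dots> = exp (- (real (n div (c + 1)) / real (card S) ^ c\<^sup>2))"
    by (simp add: exp_of_nat_mult [symmetric])
  finally show ?thesis .
qed

theorem proposition2p1:
  fixes c k :: nat and s :: "nat \<Rightarrow> nat" and S :: "nat \<Rightarrow> 'a set"
  assumes "c \<ge> 1" and "k \<ge> 1" and "c \<le> k"
    and "\<And>n. finite (S n)" and "\<And>n. card (S n) = s n"
    and "\<And>n. s n \<ge> c"
    and "(\<lambda>n. real (s n)) \<in> o(\<lambda>n. real n powr (1 / real c ^ 2))"
  shows "(\<lambda>n. colourable_prob n c k (S n)) \<longlonglongrightarrow> 0"
proof -
  \<comment> \<open>Up to the factor \<open>c + 1\<close> and rounding, \<open>r n\<close> is the
    exponent in the bound. Raising the little-o hypothesis to the power \<open>c * c\<close> turns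
    it into convergence of \<open>inverse (r n)\<close> to 0.\<close>
  define r where "r n = real n / real (s n) ^ c\<^sup>2" for n
  have s_pos: "s n > 0" for n
    using assms(1) assms(6) [of n] by simp
  have "(\<lambda>n. real (s n) / real n powr (1 / real c ^ 2)) \<longlonglongrightarrow> 0"
    using smalloD_tendsto [OF assms(7)] .
  then have "(\<lambda>n. (real (s n) / real n powr (1 / real c ^ 2)) ^ c\<^sup>2) \<longlonglongrightarrow> 0 ^ c\<^sup>2"
    by (intro tendsto_power)
  moreover have "(real (s n) / real n powr (1 / real c ^ 2)) ^ c\<^sup>2 = inverse (r n)" if "n > 0" for n
    using that assms(1) by (simp add: r_def power_divide powr_power)
  then have "\<forall>\<^sub>F n in sequentially.
      (real (s n) / real n powr (1 / real c ^ 2)) ^ c\<^sup>2 = inverse (r n)"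
    by (intro eventually_sequentiallyI [of 1]) simp
  ultimately have "(\<lambda>n. inverse (r n)) \<longlonglongrightarrow> 0 ^ c\<^sup>2"
    by (rule Lim_transform_eventually)
  then have "(\<lambda>n. inverse (r n)) \<longlonglongrightarrow> 0"
    using assms(1) by (simp add: zero_power)
  \<comment> \<open>Positivity ensures that the reciprocals tend to plus infinity and not merely in
    absolute value.\<close>
  moreover have "\<forall>\<^sub>F n in sequentially. inverse (r n) > 0"
    using s_pos by (intro eventually_sequentiallyI [of 1]) (simp add: r_def)
  ultimately have "filterlim (\<lambda>n. inverse (inverse (r n))) at_top sequentially"
    by (rule filterlim_inverse_at_top)
  then have r: "filterlim r at_top sequentially"
    by simp
  \<comment> \<open>The summand 1 pays for the rounding in \<open>n div (c + 1)\<close>: that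
    quotient falls short of \<open>n / (c + 1)\<close> by less than 1, and dividing by
    \<open>s n ^ (c * c) \<ge> 1\<close> does not enlarge the loss.\<close>
  have bound: "colourable_prob n c k (S n) \<le> exp (1 - r n / (c + 1))" for n
  proof -
    define m where "m = n div (c + 1)"
    have "n \<le> (m + 1) * (c + 1)"
      unfolding m_def using dividend_less_div_times [of "c + 1" n] by simp
    then have "real n \<le> (real m + 1) * (c + 1)"
      by (metis of_nat_1 of_nat_add of_nat_le_iff of_nat_mult)
    then have "real n / (c + 1) / real (s n) ^ c\<^sup>2 \<le> (real m + 1) / real (s n) ^ c\<^sup>2"
      by (intro divide_right_mono) (simp_all add: pos_divide_le_eq)
    then have "r n / (c + 1) \<le> (real m + 1) / real (s n) ^ c\<^sup>2"
      by (simp add: r_def mult.commute)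
    moreover have "1 / real (s n) ^ c\<^sup>2 \<le> 1"
      using s_pos [of n] by simp
    ultimately have "- (real m / real (s n) ^ c\<^sup>2) \<le> 1 - r n / (c + 1)"
      by (simp add: add_divide_distrib)
    then show ?thesis
      using colourable_prob_le_exp [of c k "S n" n] assms(1,3-6) unfolding m_def
      by (smt (verit) exp_le_cancel_iff)
  qed
  have "filterlim (\<lambda>n. r n * (1 / (c + 1))) at_top sequentially"
    by (rule filterlim_at_top_mult_tendsto_pos [OF tendsto_const _ r]) simp
  then have "filterlim (\<lambda>n. - 1 + r n / (c + 1)) at_top sequentially"
    by (intro filterlim_tendsto_add_at_top [OF tendsto_const]) simp
  then have "filterlim (\<lambda>n. 1 - r n / (c + 1)) at_bot sequentially"
    by (subst filterlim_uminus_at_bot) (simp add: algebra_simps)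
  then have "(\<lambda>n. exp (1 - r n / (c + 1))) \<longlonglongrightarrow> 0"
    by (rule filterlim_compose [OF exp_at_bot])
  then show ?thesis
  proof (rule tendsto_sandwich [OF _ _ tendsto_const, rotated 2])
    show "\<forall>\<^sub>F n in sequentially. 0 \<le> colourable_prob n c k (S n)"
      by (simp add: colourable_prob_def)
    show "\<forall>\<^sub>F n in sequentially. colourable_prob n c k (S n) \<le> exp (1 - r n / (c + 1))"
      by (rule always_eventually) (blast intro: bound)
  qed
qed

end
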